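(* Let $t\ge 1$ and $k\geq 2t$ be positive integers. For any $\alpha=(a_1,\ldots,a_k)\in \mathbb F_2^k$ with $t$ being the maximum integer such that $a_t=1$, we have, as $n\to\infty$, $$f_\alpha(n)\sim (t!\, n)^{1/t}.$$
   Context: Let $[n]=\{1,\ldots,n\}$ and let $2^{[n]}$ be the collection of all subsets of $[n]$. For $\alpha=(a_1,\ldots,a_k)\in\mathbb F_2^k$, a family $\mathcal F\subset 2^{[n]}$ is an $\alpha$-intersecting family (modulo $2$) if for each $\ell\in[k]$ and any $\ell$ distinct members $F_1,\ldots,F_\ell\in\mathcal F$ one has $|F_1\cap\cdots\cap F_\ell|\equiv a_\ell \pmod 2$. Let $f_\alpha(n)$ be the maximum size of an $\alpha$-intersecting family $\mathcal F\subset 2^{[n]}$. Here $k$ and $\alpha$ are fixed and $n\to\infty$. For $f,g:\mathbb N\to\mathbb R^+$, $f\sim g$ means $\lim_{n\to\infty}f(n)/g(n)=1$. *)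

theory Defs
  imports Complex_Main "HOL-Library.Z2" "HOL-Library.Landau_Symbols"
begin

text \<open>
  The field of two elements is \<^typ>\<open>bit\<close>. A vector \<open>(a\<^sub>1, \<dots>, a\<^sub>k)\<close> over it is a function
  \<open>\<alpha> :: nat \<Rightarrow> bit\<close> of which only the values at \<open>1, \<dots>, k\<close> are used.
\<close>

definition intersecting_family :: "nat \<Rightarrow> (nat \<Rightarrow> bit) \<Rightarrow> nat \<Rightarrow> nat set set \<Rightarrow> bool" where
  "intersecting_family k \<alpha> n \<F> \<longleftrightarrow>
     \<F> \<subseteq> Pow {1..n} \<and>
     (\<forall>l\<in>{1..k}. \<forall>\<G>\<subseteq>\<F>. card \<G> = l \<longrightarrow> of_nat (card (\<Inter>\<G>)) = \<alpha> l)"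

text \<open>
  The maximum is over a finite set, nonempty since the empty family qualifies vacuously.
\<close>

definition max_intersecting :: "nat \<Rightarrow> (nat \<Rightarrow> bit) \<Rightarrow> nat \<Rightarrow> nat" where
  "max_intersecting k \<alpha> n = Max (card ` {\<F>. intersecting_family k \<alpha> n \<F>})"

end

theory Submission
  imports Defs "HOL-Real_Asymp.Real_Asymp"
begin

text \<open>
  For the upper bound, the indicator vectors of the intersections of \<open>t\<close> distinct members of the family
  are orthonormal over the field of two elements: the union of two distinct \<open>t\<close>-sets of members has
  between \<open>t + 1\<close> and \<open>2t\<close> elements. Hence a family of size \<open>M\<close> satisfies \<open>M choose t \<le> n\<close>.

  For the lower bound, prescribe for each nonempty set \<open>X\<close> of indices whether there is a point lying in
  exactly the members indexed by \<open>X\<close>. By Moebius inversion modulo 2, taking the sum of \<open>\<alpha> (card Y)\<close>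
  over all \<open>Y \<supseteq> X\<close> gives all intersections the right parity, and no \<open>X\<close> of size above \<open>t\<close> is used.
  So \<open>m\<close> members need at most \<open>(m + t) choose t\<close> points.

  Both bounds put the maximum within \<open>t + 1\<close> of \<open>(t! n)\<^bsup>1/t\<^esup>\<close>.
\<close>

section \<open>Upper bound: orthonormal sets modulo 2\<close>

lemma of_bool_bit_eq_1 [simp]: "of_bool (x = 1) = (x :: bit)"
  by (cases x) auto

lemma sum_of_bool_mem_subset:
  assumes "finite V" "B \<subseteq> V"
  shows "(\<Sum>x\<in>V. of_bool (x \<in> B)) = (of_nat (card B) :: 'b :: comm_semiring_1)"
  using assms by (subst sum_of_bool_eq) (simp_all add: Int_absorb1)

text \<open>Orthonormal vectors are linearly independent. Counting replaces dimension theory: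
  distinct subsets of \<open>I\<close> give distinct sums of indicator vectors, so
  \<open>2 ^ card I \<le> 2 ^ card V\<close>.\<close>

lemma card_le_of_orthonormal_mod_2:
  fixes A :: "'i \<Rightarrow> 'a set"
  assumes "finite V" "finite I" and A: "\<And>i. i \<in> I \<Longrightarrow> A i \<subseteq> V"
    and orth: "\<And>i j. i \<in> I \<Longrightarrow> j \<in> I \<Longrightarrow> (of_nat (card (A i \<inter> A j)) :: bit) = of_bool (i = j)"
  shows "card I \<le> card V"
proof -
  \<comment> \<open>The support of the sum, over the field of two elements, of the indicator vectors
    of the \<open>A i\<close> with \<open>i \<in> J\<close>.\<close>
  define f where "f J = {x \<in> V. (\<Sum>i\<in>J. of_bool (x \<in> A i) :: bit) = 1}" for J
  \<comment> \<open>Pairing that sum with \<open>A j\<close> extracts the coefficient of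
    \<open>A j\<close>.\<close>
  have recover: "(of_nat (card (f J \<inter> A j)) :: bit) = of_bool (j \<in> J)" if "J \<subseteq> I" "j \<in> I" for J j
  proof -
    have fJ: "finite J" using that assms finite_subset by blast
    have "(of_nat (card (f J \<inter> A j)) :: bit) = (\<Sum>x\<in>V. of_bool (x \<in> f J \<inter> A j))"
      using assms(1) by (intro sum_of_bool_mem_subset[symmetric]) (auto simp: f_def)
    also have "\<dots> = (\<Sum>x\<in>V. (\<Sum>i\<in>J. of_bool (x \<in> A i)) * of_bool (x \<in> A j))"
      by (intro sum.cong) (auto simp: f_def)
    also have "\<dots> = (\<Sum>x\<in>V. \<Sum>i\<in>J. of_bool (x \<in> A i \<inter> A j))"
      unfolding sum_distrib_right by (intro sum.cong) auto
    also have "\<dots> = (\<Sum>i\<in>J. \<Sum>x\<in>V. of_bool (x \<in> A i \<inter> A j))"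
      by (rule sum.swap)
    also have "\<dots> = (\<Sum>i\<in>J. of_nat (card (A i \<inter> A j)))"
      using A that assms(1) by (intro sum.cong refl sum_of_bool_mem_subset) blast+
    also have "\<dots> = (\<Sum>i\<in>J. of_bool (i = j))"
      using orth that by (intro sum.cong refl) blast
    also have "\<dots> = of_bool (j \<in> J)"
      using fJ by (simp add: of_bool_def)
    finally show ?thesis .
  qed
  have "inj_on f (Pow I)"
  proof (rule inj_onI)
    fix J K assume JK: "J \<in> Pow I" "K \<in> Pow I" and "f J = f K"
    then have "j \<in> J \<longleftrightarrow> j \<in> K" if "j \<in> I" for j
      using recover[of J j] recover[of K j] that by (simp split: if_splits add: of_bool_def)
    with JK show "J = K" by blast
  qed
  moreover have "f ` Pow I \<subseteq> Pow V" by (auto simp: f_def)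
  ultimately have "card (Pow I) \<le> card (Pow V)"
    using assms(1) by (intro card_inj_on_le) auto
  then show ?thesis using assms by (simp add: card_Pow)
qed

lemma choose_card_intersecting_family_le:
  assumes \<F>: "intersecting_family k \<alpha> n \<F>"
    and "t \<ge> 1" "k \<ge> 2 * t" "\<alpha> t = 1" "\<forall>l. t < l \<and> l \<le> k \<longrightarrow> \<alpha> l = 0"
  shows "card \<F> choose t \<le> n"
proof -
  have sub: "\<F> \<subseteq> Pow {1..n}" using \<F> by (simp add: intersecting_family_def)
  then have fin: "finite \<F>" by (rule finite_subset) simp
  define I where "I = {S. S \<subseteq> \<F> \<and> card S = t}"
  have "card I \<le> card {1..n}"
  proof (rule card_le_of_orthonormal_mod_2[where A = Inter])
    show "finite I" using fin by (auto simp: I_def intro: finite_subset[of _ "Pow \<F>"])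
  next
    fix S assume S: "S \<in> I"
    \<comment> \<open>The empty family must be excluded because \<open>\<Inter>{}\<close> is
      \<open>UNIV\<close>.\<close>
    then have "S \<noteq> {}" using assms(2) by (auto simp: I_def)
    with S sub show "\<Inter>S \<subseteq> {1..n}" by (fastforce simp: I_def)
  next
    fix S T assume ST: "S \<in> I" "T \<in> I"
    then have fST: "finite S" "finite T" using fin by (auto simp: I_def intro: finite_subset)
    \<comment> \<open>This is where \<open>k \<ge> 2 * t\<close> enters: the parity of the
      intersection over \<open>S \<union> T\<close> is prescribed by \<alpha>.\<close>
    have le: "card (S \<union> T) \<le> k"
      using card_Un_le[of S T] ST assms(3) by (simp add: I_def)
    have ge: "card S \<le> card (S \<union> T)" using fST by (intro card_mono) auto
    have "(of_nat (card (\<Inter>(S \<union> T))) :: bit) = \<alpha> (card (S \<union> T))"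
      using \<F> ST le ge assms(2) unfolding intersecting_family_def I_def by (auto simp del: Inter_Un_distrib)
    moreover have "card (S \<union> T) > t" if "S \<noteq> T"
    proof (rule ccontr)
      assume "\<not> ?thesis"
      then have "S = S \<union> T" "T = S \<union> T"
        using ST fST by (intro card_seteq; simp add: I_def)+
      with that show False by blast
    qed
    ultimately show "(of_nat (card (\<Inter>S \<inter> \<Inter>T)) :: bit) = of_bool (S = T)"
      using ST le assms(4,5) by (auto simp: Inter_Un_distrib I_def)
  qed simp
  then show ?thesis using fin by (simp add: I_def n_subsets)
qed

section \<open>Lower bound: a family with prescribed parities\<close>

text \<open>A nonempty Boolean interval has \<open>2 ^ card (Y - S)\<close> elements, which is odd
  only for exponent 0.\<close>

lemma card_interval_mod_2:
  assumes "finite Y"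
  shows "(of_nat (card {X. S \<subseteq> X \<and> X \<subseteq> Y}) :: bit) = of_bool (S = Y)"
proof (cases "S \<subseteq> Y")
  case True
  have "{X. S \<subseteq> X \<and> X \<subseteq> Y} = (\<lambda>Z. S \<union> Z) ` Pow (Y - S)"
  proof (intro equalityI subsetI)
    fix X assume "X \<in> {X. S \<subseteq> X \<and> X \<subseteq> Y}"
    then have "X = S \<union> (X - S)" "X - S \<in> Pow (Y - S)" by auto
    then show "X \<in> (\<lambda>Z. S \<union> Z) ` Pow (Y - S)" by (rule image_eqI)
  qed (use True in auto)
  moreover have "inj_on (\<lambda>Z. S \<union> Z) (Pow (Y - S))" by (auto simp: inj_on_def)
  ultimately have "card {X. S \<subseteq> X \<and> X \<subseteq> Y} = 2 ^ card (Y - S)"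
    using assms by (simp add: card_image card_Pow)
  moreover have "card (Y - S) = 0 \<longleftrightarrow> S = Y" using assms True by auto
  ultimately show ?thesis by (cases "card (Y - S)") auto
next
  case False
  then have eq: "{X. S \<subseteq> X \<and> X \<subseteq> Y} = {}" by auto
  show ?thesis unfolding eq using False by auto
qed

text \<open>After swapping the sums, \<open>g Y\<close> occurs once for each \<open>X\<close>
  between \<open>S\<close> and \<open>Y\<close>, an odd number of times only if
  \<open>Y = S\<close>. The signs of Moebius inversion vanish modulo 2, so summing over supersets is
  its own inverse.\<close>

lemma moebius_inversion_mod_2:
  fixes g :: "'a set \<Rightarrow> bit"
  assumes "finite V" "S \<subseteq> V"
  shows "(\<Sum>X | S \<subseteq> X \<and> X \<subseteq> V. \<Sum>Y | X \<subseteq> Y \<and> Y \<subseteq> V. g Y) = g S"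
proof -
  have fin: "finite {X. S \<subseteq> X \<and> X \<subseteq> V}" using assms by (auto intro: finite_subset[of _ "Pow V"])
  have "(\<Sum>X | S \<subseteq> X \<and> X \<subseteq> V. \<Sum>Y | X \<subseteq> Y \<and> Y \<subseteq> V. g Y)
      = (\<Sum>X | S \<subseteq> X \<and> X \<subseteq> V. \<Sum>Y | Y \<in> {X. S \<subseteq> X \<and> X \<subseteq> V} \<and> X \<subseteq> Y. g Y)"
    by (intro sum.cong refl) auto
  also have "\<dots> = (\<Sum>Y | S \<subseteq> Y \<and> Y \<subseteq> V. \<Sum>X | X \<in> {X. S \<subseteq> X \<and> X \<subseteq> V} \<and> X \<subseteq> Y. g Y)"
    by (rule sum.swap_restrict[OF fin fin])
  also have "\<dots> = (\<Sum>Y | S \<subseteq> Y \<and> Y \<subseteq> V. of_bool (S = Y) * g Y)"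
  proof (intro sum.cong refl)
    fix Y assume Y: "Y \<in> {Y. S \<subseteq> Y \<and> Y \<subseteq> V}"
    then have "{X \<in> {X. S \<subseteq> X \<and> X \<subseteq> V}. X \<subseteq> Y} = {X. S \<subseteq> X \<and> X \<subseteq> Y}" by auto
    moreover have "finite Y" using Y assms finite_subset by blast
    ultimately show "(\<Sum>X | X \<in> {X. S \<subseteq> X \<and> X \<subseteq> V} \<and> X \<subseteq> Y. g Y) = of_bool (S = Y) * g Y"
      by (simp add: card_interval_mod_2)
  qed
  also have "\<dots> = (\<Sum>Y | S \<subseteq> Y \<and> Y \<subseteq> V. if S = Y then g Y else 0)"
    by (intro sum.cong) auto
  also have "\<dots> = g S" using fin assms by simp
  finally show ?thesis .
qed

lemma card_subsets_card_le:
  assumes "finite V"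
  shows "card {X. X \<subseteq> V \<and> card X \<le> t} \<le> (card V + t) choose t"
proof -
  have eq: "{X. X \<subseteq> V \<and> card X \<le> t} = (\<Union>j\<le>t. {X. X \<subseteq> V \<and> card X = j})" by auto
  have "card {X. X \<subseteq> V \<and> card X \<le> t} = (\<Sum>j\<le>t. card {X. X \<subseteq> V \<and> card X = j})"
    unfolding eq using assms by (intro card_UN_disjoint) (auto intro: finite_subset[of _ "Pow V"])
  also have "\<dots> = (\<Sum>j\<le>t. card V choose j)" using assms by (simp add: n_subsets)
  \<comment> \<open>The inserted factor is at least 1 since \<open>j \<le> t\<close>; it prepares
    the Vandermonde identity.\<close>
  also have "\<dots> \<le> (\<Sum>j\<le>t. (card V choose j) * (t choose (t - j)))"
    by (intro sum_mono) (simp add: Suc_leI)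
  also have "\<dots> = (card V + t) choose t" by (rule vandermonde)
  finally show ?thesis .
qed

lemma intersecting_family_exists:
  assumes "t \<ge> 1" "t \<le> k" and \<alpha>: "\<alpha> t = 1" "\<forall>l. t < l \<and> l \<le> k \<longrightarrow> \<alpha> l = 0"
    and "t < m" and n: "(m + t) choose t \<le> n"
  shows "\<exists>\<F>. intersecting_family k \<alpha> n \<F> \<and> card \<F> = m"
proof -
  \<comment> \<open>The cutoff is needed since \<open>m\<close> may exceed \<open>k\<close>, beyond
    which \<alpha> is arbitrary. The equally arbitrary \<open>\<alpha> 0\<close> only affects
    \<open>w {}\<close>, hence at most a point lying in no member.\<close>
  define g where "g Y = (if card Y \<le> t then \<alpha> (card Y) else 0)" for Y :: "nat set"
  define w where "w X = (\<Sum>Y | X \<subseteq> Y \<and> Y \<subseteq> {..<m}. g Y)" for X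
  define P where "P = {X. X \<subseteq> {..<m} \<and> w X = 1}"
  have card_le: "card X \<le> t" if "X \<in> P" for X
  proof (rule ccontr)
    assume "\<not> card X \<le> t"
    moreover have "card X \<le> card Y" if "X \<subseteq> Y" "Y \<subseteq> {..<m}" for Y
      using that by (meson card_mono finite_lessThan finite_subset)
    ultimately have "g Y = 0" if "X \<subseteq> Y" "Y \<subseteq> {..<m}" for Y
      using that unfolding g_def by (meson le_trans)
    then have "w X = 0" unfolding w_def by (intro sum.neutral) simp
    with that show False by (simp add: P_def)
  qed
  \<comment> \<open>These \<open>t\<close>-sets serve to tell the members apart.\<close>
  have mem_P: "X \<in> P" if X: "X \<subseteq> {..<m}" "card X = t" for X
  proof -
    have "g Y = (if Y = X then 1 else 0)" if Y: "X \<subseteq> Y" "Y \<subseteq> {..<m}" for Y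
    proof -
      have "finite Y" using Y finite_subset by blast
      then have "card Y \<le> t \<longleftrightarrow> Y = X" using X Y card_seteq by blast
      then show ?thesis using \<alpha> X by (auto simp: g_def)
    qed
    then have "w X = (\<Sum>Y | X \<subseteq> Y \<and> Y \<subseteq> {..<m}. if Y = X then 1 else 0)"
      unfolding w_def by (intro sum.cong) auto
    also have "\<dots> = 1"
      using X by (subst sum.delta) (auto intro: finite_subset[of _ "Pow {..<m}"])
    finally show ?thesis using X by (simp add: P_def)
  qed
  have finP: "finite P" by (auto simp: P_def intro: finite_subset[of _ "Pow {..<m}"])
  have "card P \<le> card {X. X \<subseteq> {..<m} \<and> card X \<le> t}"
    using card_le by (intro card_mono) (auto simp: P_def intro: finite_subset[of _ "Pow {..<m}"])
  also have "\<dots> \<le> card {1..n}" using card_subsets_card_le[of "{..<m}" t] n by simp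
  \<comment> \<open>The sets in \<open>P\<close> are realised as points of the ground set;
    \<open>F i\<close> collects the points whose set contains \<open>i\<close>.\<close>
  finally obtain \<phi> where \<phi>: "\<phi> ` P \<subseteq> {1..n}" "inj_on \<phi> P"
    using card_le_inj[OF finP, of "{1..n}"] by auto
  define F where "F i = \<phi> ` {X \<in> P. i \<in> X}" for i
  have mem_F: "\<phi> X \<in> F i \<longleftrightarrow> i \<in> X" if "X \<in> P" for X i
    using that \<phi>(2) by (auto simp: F_def inj_on_def)
  have inj: "inj_on F {..<m}"
  proof (rule inj_onI, rule ccontr)
    fix i j assume ij: "i \<in> {..<m}" "j \<in> {..<m}" "F i = F j" "i \<noteq> j"
    \<comment> \<open>Since \<open>t < m\<close>, some \<open>t\<close>-set contains
      \<open>i\<close> but not \<open>j\<close>; its point lies in \<open>F i\<close> and not in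
      \<open>F j\<close>.\<close>
    have "t - 1 \<le> card ({..<m} - {i, j})" using ij \<open>t < m\<close> by (simp add: card_Diff_subset)
    then obtain Z where Z: "Z \<subseteq> {..<m} - {i, j}" "card Z = t - 1" "finite Z"
      by (meson obtain_subset_with_card_n)
    then have "card (insert i Z) = t" using \<open>t \<ge> 1\<close> by (subst card_insert_disjoint) auto
    then have "insert i Z \<in> P" using Z ij by (intro mem_P) auto
    from mem_F[OF this, of i] mem_F[OF this, of j] show False using ij Z by auto
  qed
  have "intersecting_family k \<alpha> n (F ` {..<m})"
    unfolding intersecting_family_def
  proof (intro conjI ballI allI impI)
    show "F ` {..<m} \<subseteq> Pow {1..n}" using \<phi> by (auto simp: F_def)
  next
    fix l \<G> assume l: "l \<in> {1..k}" and "\<G> \<subseteq> F ` {..<m}" and cG: "card \<G> = l"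
    then obtain S where S: "S \<subseteq> {..<m}" "\<G> = F ` S" by (meson subset_image_iff)
    then have cS: "card S = l" using cG inj by (metis card_image inj_on_subset)
    then obtain s where "s \<in> S" using l by fastforce
    have "\<Inter>\<G> = \<phi> ` {X \<in> P. S \<subseteq> X}"
    proof (intro equalityI subsetI)
      fix y assume y: "y \<in> \<Inter>\<G>"
      then have "y \<in> F s" using S \<open>s \<in> S\<close> by auto
      then obtain X where X: "X \<in> P" "y = \<phi> X" by (auto simp: F_def)
      then have "S \<subseteq> X" using y S mem_F[of X] by auto
      with X show "y \<in> \<phi> ` {X \<in> P. S \<subseteq> X}" by auto
    qed (auto simp: S mem_F)
    moreover have "inj_on \<phi> {X \<in> P. S \<subseteq> X}" using \<phi>(2) by (rule inj_on_subset) auto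
    ultimately have "card (\<Inter>\<G>) = card {X \<in> P. S \<subseteq> X}" by (simp add: card_image)
    also have "{X \<in> P. S \<subseteq> X} = {X. S \<subseteq> X \<and> X \<subseteq> {..<m}} \<inter> {X. w X = 1}"
      by (auto simp: P_def)
    finally have "(of_nat (card (\<Inter>\<G>)) :: bit)
        = (\<Sum>X | S \<subseteq> X \<and> X \<subseteq> {..<m}. of_bool (w X = 1))"
      by (subst sum_of_bool_eq) (auto intro: finite_subset[of _ "Pow {..<m}"])
    \<comment> \<open>As \<open>w\<close> takes values in the field of two elements, it is its own
      indicator, and the count modulo 2 is a superset sum of \<open>w\<close>.\<close>
    also have "\<dots> = (\<Sum>X | S \<subseteq> X \<and> X \<subseteq> {..<m}. w X)" by simp
    also have "\<dots> = g S" unfolding w_def using S by (intro moebius_inversion_mod_2) auto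
    also have "\<dots> = \<alpha> l" using \<alpha> l cS by (auto simp: g_def)
    finally show "(of_nat (card (\<Inter>\<G>)) :: bit) = \<alpha> l" .
  qed
  moreover have "card (F ` {..<m}) = m" using inj by (simp add: card_image)
  ultimately show ?thesis by blast
qed

section \<open>From the two bounds to the asymptotics\<close>

lemma finite_intersecting_families: "finite {\<F>. intersecting_family k \<alpha> n \<F>}"
  by (rule finite_subset[of _ "Pow (Pow {1..n})"]) (auto simp: intersecting_family_def)

lemma max_intersecting_attained:
  obtains \<F> where "intersecting_family k \<alpha> n \<F>" "card \<F> = max_intersecting k \<alpha> n"
proof -
  have "intersecting_family k \<alpha> n {}" by (auto simp: intersecting_family_def)
  then have "max_intersecting k \<alpha> n \<in> card ` {\<F>. intersecting_family k \<alpha> n \<F>}"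
    unfolding max_intersecting_def using finite_intersecting_families by (intro Max_in) auto
  then show ?thesis using that by auto
qed

lemma card_le_max_intersecting:
  "intersecting_family k \<alpha> n \<F> \<Longrightarrow> card \<F> \<le> max_intersecting k \<alpha> n"
  unfolding max_intersecting_def using finite_intersecting_families by (intro Max_ge) auto

text \<open>The right side is the product of \<open>d + 1\<close>, ..., \<open>d + t\<close>, each
  factor at least \<open>d\<close>.\<close>

lemma power_le_fact_mult_choose: "d ^ t \<le> fact t * ((d + t) choose t)"
proof (induction t)
  case (Suc t)
  have "d ^ Suc t \<le> (d + t + 1) * (fact t * ((d + t) choose t))"
    using Suc by (simp only: power_Suc) (intro mult_mono, auto)
  also have "\<dots> = fact t * (Suc (d + t) * ((d + t) choose t))"
    by (simp add: algebra_simps)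
  also have "\<dots> = fact t * ((Suc (d + t) choose Suc t) * Suc t)"
    by (simp only: Suc_times_binomial_eq)
  finally show ?case by (simp add: algebra_simps)
qed simp

theorem theoremI1:
  fixes t k :: nat and \<alpha> :: "nat \<Rightarrow> bit"
  assumes "t \<ge> 1" and "k \<ge> 2 * t"
    and "\<alpha> t = 1" and "\<forall>l. t < l \<and> l \<le> k \<longrightarrow> \<alpha> l = 0"
  shows "(\<lambda>n. real (max_intersecting k \<alpha> n)) \<sim>[at_top]
           (\<lambda>n. (fact t * real n) powr (1 / real t))"
proof -
  define M where "M n = real (max_intersecting k \<alpha> n)" for n
  define g where "g n = (fact t * real n) powr (1 / real t)" for n
  have g_power: "g n ^ t = fact t * real n" for n
  proof (cases "n = 0")
    case False
    then have "g n ^ t = g n powr real t" by (simp add: g_def powr_realpow)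
    with False \<open>t \<ge> 1\<close> show ?thesis by (simp add: g_def powr_powr)
  qed (use \<open>t \<ge> 1\<close> in \<open>simp add: g_def\<close>)
  have g_nonneg: "g n \<ge> 0" for n by (simp add: g_def)
  have g_top: "filterlim g at_top at_top"
    unfolding g_def using \<open>t \<ge> 1\<close> by real_asymp
  have upper: "M n \<le> g n + t" for n
  proof -
    obtain \<F> where "intersecting_family k \<alpha> n \<F>" "card \<F> = max_intersecting k \<alpha> n"
      by (rule max_intersecting_attained)
    then have le: "max_intersecting k \<alpha> n choose t \<le> n"
      using choose_card_intersecting_family_le assms by metis
    show ?thesis
    proof (cases "max_intersecting k \<alpha> n \<le> t")
      case True
      then show ?thesis using g_nonneg[of n] by (simp add: M_def)
    next
      case False
      \<comment> \<open>Shifting by \<open>t\<close> turns the binomial bound into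
        \<open>d ^ t \<le> fact t * n\<close>, at the cost of an additive \<open>t\<close>.\<close>
      define d where "d = max_intersecting k \<alpha> n - t"
      have eq: "max_intersecting k \<alpha> n = d + t" using False by (simp add: d_def)
      have "d ^ t \<le> fact t * n"
        using power_le_fact_mult_choose[of d t] le unfolding eq by (meson le_trans mult_le_mono2)
      then have "real d ^ t \<le> g n ^ t"
        unfolding g_power by (metis of_nat_fact of_nat_le_iff of_nat_mult of_nat_power)
      then have "real d \<le> g n" using \<open>t \<ge> 1\<close> g_nonneg by (simp add: power_mono_iff)
      then show ?thesis by (simp add: M_def eq)
    qed
  qed
  \<comment> \<open>The threshold makes the floor of \<open>g n\<close> at least
    \<open>2 * t + 1\<close>, so that \<open>m > t\<close> below.\<close>
  have lower: "g n - t - 1 \<le> M n" if "g n > 2 * real t + 1" for n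
  proof -
    \<comment> \<open>Chosen so that \<open>m + t\<close> is the floor of \<open>g n\<close>; then
      \<open>(m + t) choose t\<close> is at most \<open>g n ^ t / fact t\<close>, which is
      \<open>n\<close>.\<close>
    define m where "m = nat \<lfloor>g n\<rfloor> - t"
    have mt: "m + t = nat \<lfloor>g n\<rfloor>" "t < m" using that by (auto simp: m_def) linarith+
    have "fact t * ((m + t) choose t) \<le> (m + t) ^ t"
      using binomial_fact_pow[of "m + t" t] by (simp add: mult.commute)
    then have "fact t * real ((m + t) choose t) \<le> real (m + t) ^ t"
      by (metis of_nat_fact of_nat_le_iff of_nat_mult of_nat_power)
    also have "\<dots> \<le> g n ^ t"
      using g_nonneg[of n] by (intro power_mono) (simp_all add: mt)
    finally have "(m + t) choose t \<le> n" unfolding g_power by simp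
    then obtain \<F> where "intersecting_family k \<alpha> n \<F>" "card \<F> = m"
      using intersecting_family_exists[of t k \<alpha> m n] assms mt by auto
    then have "real m \<le> M n" using card_le_max_intersecting by (fastforce simp: M_def)
    moreover have "real (m + t) \<ge> g n - 1" unfolding mt(1) using g_nonneg[of n] by linarith
    ultimately show ?thesis by simp
  qed
  \<comment> \<open>The error is eventually bounded by \<open>t + 1\<close>, while \<open>g\<close>
    tends to infinity.\<close>
  have "(\<lambda>n. M n - g n) \<in> o(g)"
  proof -
    have "eventually (\<lambda>n. norm (M n - g n) \<le> (real t + 1) * norm (1 :: real)) at_top"
      using filterlim_at_top_dense[THEN iffD1, OF g_top, rule_format, of "2 * real t + 1"]
    proof eventually_elim
      case (elim n)
      then show ?case using upper[of n] lower[of n] by (auto simp: abs_le_iff)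
    qed
    then have "(\<lambda>n. M n - g n) \<in> O(\<lambda>_. 1)" by (rule bigoI)
    also have "(\<lambda>_. 1) \<in> o(g)"
      using filterlim_at_top_imp_at_infinity[OF g_top]
      by (simp only: smallomega_1_conv_filterlim flip: smallomega_iff_smallo)
    finally show ?thesis .
  qed
  then have "M \<sim>[at_top] g" by (rule smallo_imp_asymp_equiv)
  then show ?thesis unfolding M_def g_def .
qed

end
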